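(* Let $0<\Delta\le1$ and $T=\frac{\lambda_1}{2\Delta}\ln\frac1\Delta$, and use the quantizer $q_o$ with variable-length encoding. There exist constants $C_6,C_8>0$, independent of $P$ and of the feedback rates (and of $\Delta$), such that for all $P>0$ $$\mathtt{out}_{{\rm loss},q_o}\le C_8\,e^{-C_6/P}\,\frac{1+\sqrt P}{P}\,2^{-\frac{\min\{R_{o,{\rm VLE},1},R_{o,{\rm VLE},2}\}}{2}}.$$
   Context: $H_1,H_2$ are independent exponential random variables with means $\lambda_1\ge\lambda_2>0$ (density $e^{-x/\lambda_i}/\lambda_i$, $x>0$); $P>0$ is total power; $r_{\rm th}>0$ is a fixed target rate. For $a\ge b\ge0$, $a>0$, let $A(a,b)=\frac{2b}{\sqrt{(a+b)^2+4ab^2P}+a+b}$. Full CSI: $r_{\max}=\log_2(1+PH_1A(H_1,H_2))$ if $H_1\ge H_2$, $r_{\max}=\log_2(1+PH_2A(H_2,H_1))$ if $H_1<H_2$; $\mathtt{out}_{\min}=\Pr\{r_{\max}<r_{\rm th}\}$. Quantizer with $\Delta>0$, $T\ge0$: $q_o(x)=\lceil x/\Delta\rceil\Delta$ for $x\le T\Delta$, $q_o(x)=(T+1)\Delta$ for $x>T\Delta$. Let $a_i=q_o(H_i)$; if $a_1\ge a_2$ let $(s,w)=(1,2)$, otherwise $(s,w)=(2,1)$; $\alpha_q=A(a_s,a_w)$ if $a_1,a_2>0$, else $\alpha_q=0$. Actual rates $R_s=\log_2(1+P\alpha_qH_s)$, $R_w=\log_2\big(1+\frac{PH_w(1-\alpha_q)}{PH_w\alpha_q+1}\big)$,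 $r_q=\min\{R_1,R_2\}$, $\mathtt{out}_q=\Pr\{r_q<r_{\rm th}\}$, $\mathtt{out}_{{\rm loss},q_o}=\mathtt{out}_q-\mathtt{out}_{\min}$. Variable-length encoding: the index $n$ with $q_o(x)=n\Delta$ is sent as the $n$-th string in the list $0,1,00,01,10,11,000,\dots$, of length $\lfloor\log_2(n+2)\rfloor$; the feedback rate $R_{o,{\rm VLE},i}$ of Receiver $i$ is the expected codeword length $\mathbb{E}[\lfloor\log_2(n(H_i)+2)\rfloor]$, where $n(x)=\lceil x/\Delta\rceil$ for $x\le T\Delta$ and $n(x)=T+1$ otherwise. *)

theory Defs
  imports "HOL-Probability.Probability"
begin

definition Acoef :: "real \<Rightarrow> real \<Rightarrow> real \<Rightarrow> real" where
  "Acoef P a b = 2 * b / (sqrt ((a + b)^2 + 4 * a * b^2 * P) + a + b)"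

definition rmax :: "real \<Rightarrow> real \<Rightarrow> real \<Rightarrow> real" where
  "rmax P h1 h2 = (if h1 \<ge> h2 then log 2 (1 + P * h1 * Acoef P h1 h2)
                   else log 2 (1 + P * h2 * Acoef P h2 h1))"

definition qo :: "real \<Rightarrow> real \<Rightarrow> real \<Rightarrow> real" where
  "qo Delta T x = (if x \<le> T * Delta then real_of_int \<lceil>x / Delta\<rceil> * Delta else (T + 1) * Delta)"

definition qidx :: "real \<Rightarrow> real \<Rightarrow> real \<Rightarrow> real" where
  "qidx Delta T x = (if x \<le> T * Delta then real_of_int \<lceil>x / Delta\<rceil> else T + 1)"

definition alpha_q :: "real \<Rightarrow> real \<Rightarrow> real \<Rightarrow> real \<Rightarrow> real \<Rightarrow> real" where
  "alpha_q P Delta T h1 h2 =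
     (let a1 = qo Delta T h1; a2 = qo Delta T h2 in
      if a1 > 0 \<and> a2 > 0 then (if a1 \<ge> a2 then Acoef P a1 a2 else Acoef P a2 a1) else 0)"

definition Rstrong :: "real \<Rightarrow> real \<Rightarrow> real \<Rightarrow> real" where
  "Rstrong P al h = log 2 (1 + P * al * h)"

definition Rweak :: "real \<Rightarrow> real \<Rightarrow> real \<Rightarrow> real" where
  "Rweak P al h = log 2 (1 + P * h * (1 - al) / (P * h * al + 1))"

definition rq :: "real \<Rightarrow> real \<Rightarrow> real \<Rightarrow> real \<Rightarrow> real \<Rightarrow> real" where
  "rq P Delta T h1 h2 =
     (let al = alpha_q P Delta T h1 h2 in
      if qo Delta T h1 \<ge> qo Delta T h2
      then min (Rstrong P al h1) (Rweak P al h2)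
      else min (Rweak P al h1) (Rstrong P al h2))"

definition chanM :: "real \<Rightarrow> real \<Rightarrow> (real \<times> real) measure" where
  "chanM lam1 lam2 = density lborel (exponential_density (1 / lam1))
                     \<Otimes>\<^sub>M density lborel (exponential_density (1 / lam2))"

definition out_min :: "real \<Rightarrow> real \<Rightarrow> real \<Rightarrow> real \<Rightarrow> real" where
  "out_min lam1 lam2 P rth =
     measure (chanM lam1 lam2) {h \<in> space (chanM lam1 lam2). rmax P (fst h) (snd h) < rth}"

definition out_q :: "real \<Rightarrow> real \<Rightarrow> real \<Rightarrow> real \<Rightarrow> real \<Rightarrow> real \<Rightarrow> real" where
  "out_q lam1 lam2 P rth Delta T =
     measure (chanM lam1 lam2) {h \<in> space (chanM lam1 lam2). rq P Delta T (fst h) (snd h) < rth}"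

definition out_loss :: "real \<Rightarrow> real \<Rightarrow> real \<Rightarrow> real \<Rightarrow> real \<Rightarrow> real \<Rightarrow> real" where
  "out_loss lam1 lam2 P rth Delta T = out_q lam1 lam2 P rth Delta T - out_min lam1 lam2 P rth"

definition R_VLE :: "real \<Rightarrow> real \<Rightarrow> real \<Rightarrow> real" where
  "R_VLE lam Delta T =
     (\<integral>x. real_of_int \<lfloor>log 2 (qidx Delta T x + 2)\<rfloor> \<partial>(density lborel (exponential_density (1 / lam))))"

end

theory Submission
  imports Defs
begin

text \<open>
  Put \<open>c = 2 powr rth - 1\<close>. With strong gain \<open>a\<close> and weak gain \<open>b\<close>, full CSI avoids outage iff
  \<open>c / b + c (1 + c) / a \<le> P\<close>, so a loss can only occur when both gains are at least \<open>c / P\<close>; this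
  gives the factor \<open>exp (- C6 / P)\<close>. The coefficient \<open>Acoef P a b\<close> is the positive root of
  \<open>P a z\<^sup>2 + (a / b + 1) z = 1\<close>, and comparing it with the threshold values of \<open>z\<close> shows that a loss
  forces the smaller gain to be \<open>O(1 / P)\<close> or \<open>O(sqrt (Delta / P))\<close>, or both gains to be overloaded
  with \<open>Delta = O(1 / P)\<close>. When the smaller gain is \<open>O(1 / P)\<close>, a further factor \<open>sqrt Delta\<close> comes
  either from the other gain (overloaded with probability at most \<open>sqrt Delta\<close>, below \<open>sqrt Delta\<close>, or
  within \<open>Delta\<close> of the smaller one), or from the smaller gain lying within \<open>O(sqrt Delta / P)\<close> of the
  boundary of the full-CSI outage region. Hence the loss is
  \<open>O(exp (- C6 / P) (1 + sqrt P) / P sqrt Delta)\<close>, and Jensen's inequality bounds the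
  feedback rate by \<open>log 2 (lam2 / Delta + 3)\<close>, that is, \<open>sqrt Delta\<close> by a multiple of \<open>2 powr (- R / 2)\<close>.
\<close>

section \<open>The coefficient as a root of a quadratic\<close>

text \<open>\<open>Acoef\<close> is the quadratic formula with rationalised numerator, scaled by
  \<open>b\<close>. Everything below uses only these two facts, so no square root of the
  discriminant appears again.\<close>

lemma Acoef_quadratic:
  assumes "P > 0" "a > 0" "b > 0"
  shows Acoef_pos: "Acoef P a b > 0"
    and Acoef_root: "P * a * (Acoef P a b)\<^sup>2 + (a / b + 1) * Acoef P a b = 1"
proof -
  define s where "s = sqrt ((a + b)^2 + 4 * a * b^2 * P)"
  have s2: "s\<^sup>2 = (a + b)^2 + 4 * a * b^2 * P" and s0: "s \<ge> 0"
    using assms unfolding s_def by auto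
  have d: "s + a + b > 0" using s0 assms by linarith
  have A: "Acoef P a b = 2 * b / (s + a + b)" unfolding Acoef_def s_def by simp
  show "Acoef P a b > 0" using d assms by (simp add: A)
  have "P * a * (2 * b)\<^sup>2 + (a / b + 1) * (2 * b) * (s + a + b) = (s + a + b)\<^sup>2"
    using s2 assms by (simp add: field_simps power2_eq_square)
  moreover have "P * a * (2 * b / d)\<^sup>2 + (a / b + 1) * (2 * b / d)
      = (P * a * (2 * b)\<^sup>2 + (a / b + 1) * (2 * b) * d) / d\<^sup>2" if "d > 0" for d
    using that by (simp add: add_divide_distrib power_divide power2_eq_square)
  ultimately show "P * a * (Acoef P a b)\<^sup>2 + (a / b + 1) * Acoef P a b = 1"
    unfolding A using d by simp
qed

text \<open>The quadratic increases strictly on the nonnegative reals. Comparing its root with a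
  threshold therefore means comparing its value at the threshold with 1.\<close>

lemma Acoef_lessD:
  assumes "P > 0" "a > 0" "b > 0" "Acoef P a b < \<beta>"
  shows "1 < P * a * \<beta>\<^sup>2 + (a / b + 1) * \<beta>"
proof -
  have "(Acoef P a b)\<^sup>2 < \<beta>\<^sup>2"
    using Acoef_pos[OF assms(1-3)] assms(4) by (intro power_strict_mono) auto
  then have "P * a * (Acoef P a b)\<^sup>2 < P * a * \<beta>\<^sup>2" using assms by simp
  moreover have "(a / b + 1) * Acoef P a b < (a / b + 1) * \<beta>"
    using assms by (intro mult_strict_left_mono) (auto simp: add_pos_pos)
  ultimately show ?thesis using Acoef_root[OF assms(1-3)] by linarith
qed

lemma Acoef_geD:
  assumes "P > 0" "a > 0" "b > 0" "0 \<le> \<beta>" "\<beta> \<le> Acoef P a b"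
  shows "P * a * \<beta>\<^sup>2 + (a / b + 1) * \<beta> \<le> 1"
proof -
  have "\<beta>\<^sup>2 \<le> (Acoef P a b)\<^sup>2" using assms by (intro power_mono) auto
  then have "P * a * \<beta>\<^sup>2 \<le> P * a * (Acoef P a b)\<^sup>2" using assms by simp
  moreover have "(a / b + 1) * \<beta> \<le> (a / b + 1) * Acoef P a b"
    using assms by (intro mult_left_mono) (auto simp: add_pos_pos less_imp_le)
  ultimately show ?thesis using Acoef_root[OF assms(1-3)] by linarith
qed

text \<open>At 1/2 the linear term alone already reaches 1 when \<open>b \<le> a\<close>.\<close>

lemma Acoef_le_half:
  assumes "P > 0" "a > 0" "b > 0" "b \<le> a"
  shows "Acoef P a b \<le> 1 / 2"
proof (rule ccontr)
  assume "\<not> ?thesis"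
  then have "P * a * (1/2)\<^sup>2 + (a / b + 1) * (1/2) \<le> 1"
    using assms by (intro Acoef_geD) auto
  moreover have "P * a * (1/2)\<^sup>2 > 0" using assms by auto
  moreover have "1 \<le> (a / b + 1) * (1/2)" using assms by (simp add: field_simps)
  ultimately show False by linarith
qed

section \<open>Gain conditions for success and failure\<close>

text \<open>The strong receiver needs a coefficient of at least \<open>c / (P * a)\<close>. The
  quadratic at this threshold, multiplied by \<open>P\<close>, is exactly the left-hand
  side.\<close>

lemma full_csi_feasible:
  assumes "P > 0" "a > 0" "b > 0" "c > 0" "c \<le> P * a * Acoef P a b"
  shows "c / b + c * (1 + c) / a \<le> P"
proof -
  have "P * a * (c / (P * a))\<^sup>2 + (a / b + 1) * (c / (P * a)) \<le> 1"
    using assms by (intro Acoef_geD) (auto simp: field_simps)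
  then have "P * (P * a * (c / (P * a))\<^sup>2 + (a / b + 1) * (c / (P * a))) \<le> P * 1"
    using assms by (intro mult_left_mono) auto
  also have "P * (P * a * (c / (P * a))\<^sup>2 + (a / b + 1) * (c / (P * a))) = c / b + c * (1 + c) / a"
    using assms by (simp add: field_simps power2_eq_square)
  finally show ?thesis by simp
qed

text \<open>The coefficient is computed from quantized gains but acts on the true gain
  \<open>x\<close>, so the threshold is \<open>c / (P * x)\<close>. For \<open>x' = x\<close> and
  \<open>y' = y\<close> the right-hand side is the full-CSI requirement
  \<open>c / y + c * (1 + c) / x\<close>.\<close>

lemma strong_failure_bound:
  assumes "P > 0" "x > 0" "x' > 0" "y' > 0" "c > 0" "P * Acoef P x' y' * x < c"
  shows "P < c\<^sup>2 * x' / x\<^sup>2 + (x' / y' + 1) * c / x"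
proof -
  have "1 < P * x' * (c / (P * x))\<^sup>2 + (x' / y' + 1) * (c / (P * x))"
    using assms by (intro Acoef_lessD) (auto simp: field_simps)
  then have "P * 1 < P * (P * x' * (c / (P * x))\<^sup>2 + (x' / y' + 1) * (c / (P * x)))"
    using assms by (intro mult_strict_left_mono) auto
  also have "\<dots> = c\<^sup>2 * x' / x\<^sup>2 + (x' / y' + 1) * c / x"
    using assms by (simp add: field_simps power2_eq_square)
  finally show ?thesis by simp
qed

lemma weak_failure_coarse:
  assumes "P > 0" "x' > 0" "y' > 0" "y' \<le> x'" "y > 0" "c > 0"
    and "P * y * (1 - Acoef P x' y') < c * (P * y * Acoef P x' y' + 1)"
  shows "y \<le> 4 * c / P \<or> x' \<le> 16 * c\<^sup>2 / P"
\<comment> \<open>Below this level the interference costs at most a quarter of \<open>P * y\<close>,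
  while the signal keeps at least half. Above it, the quadratic term alone forces \<open>x'\<close>
  to be small.\<close>
proof (cases "Acoef P x' y' \<le> 1 / (4 * c)")
  case True
  have "P * y * (1/2) \<le> P * y * (1 - Acoef P x' y')"
    using Acoef_le_half[OF assms(1-4)] assms by (intro mult_left_mono) auto
  moreover have "c * (P * y * Acoef P x' y' + 1) \<le> c * (P * y * (1 / (4 * c)) + 1)"
    using True assms by (intro mult_left_mono add_right_mono) auto
  moreover have "\<dots> = P * y / 4 + c" using assms by (simp add: field_simps)
  ultimately have "P * y \<le> 4 * c" using assms(7) by linarith
  then show ?thesis using assms by (simp add: field_simps)
next
  case False
  then have "P * x' * (1 / (4 * c))\<^sup>2 + (x' / y' + 1) * (1 / (4 * c)) \<le> 1"
    using assms by (intro Acoef_geD) auto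
  moreover have "(x' / y' + 1) * (1 / (4 * c)) \<ge> 0" using assms by auto
  ultimately have "P * x' * (1 / (4 * c))\<^sup>2 \<le> 1" by linarith
  then show ?thesis using assms by (simp add: field_simps power2_eq_square)
qed

text \<open>\<open>y0\<close> is the weak gain on the boundary of the full-CSI outage region for the
  given \<open>x\<close>. Since \<open>y'\<close> is not below \<open>y\<close>, quantization raises
  the power requirement only by an error of relative size \<open>D / x\<close>, so \<open>y\<close>
  can exceed \<open>y0\<close> only slightly.\<close>

lemma strong_failure_thin:
  assumes "P > 0" "D > 0" "0 < y" "y \<le> x" "x \<le> x'" "x' \<le> x + D" "y \<le> y'" "c > 0"
    and fail: "P * Acoef P x' y' * x < c" and full: "c / y0 = P - c * (1 + c) / x" and "y0 > 0"
  shows "y \<le> y0 + (1 + c) * y0 * (D / x)"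
proof -
  have x: "x > 0" "x' > 0" "y' > 0" using assms by auto
  have "P < c\<^sup>2 * x' / x\<^sup>2 + (x' / y' + 1) * c / x"
    by (rule strong_failure_bound) (use assms x in auto)
  also have "\<dots> \<le> c\<^sup>2 * (x + D) / x\<^sup>2 + ((x + D) / y + 1) * c / x"
    using assms x by (intro add_mono divide_right_mono mult_right_mono mult_left_mono frac_le) auto
  also have "\<dots> = c / y + c * (1 + c) / x + (c\<^sup>2 / x + c / y) * (D / x)"
    using assms x by (simp add: field_simps power2_eq_square)
  finally have "c / y0 < c / y + (c\<^sup>2 / x + c / y) * (D / x)" using full by linarith
  \<comment> \<open>This factor turns the comparison of reciprocals into one of the gains
    themselves.\<close>
  then have "c / y0 * (y0 * y / c) < (c / y + (c\<^sup>2 / x + c / y) * (D / x)) * (y0 * y / c)"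
    using assms by (intro mult_strict_right_mono) auto
  moreover have "c / y0 * (y0 * y / c) = y" using \<open>c > 0\<close> \<open>y0 > 0\<close> by simp
  moreover have "(c / y + (c\<^sup>2 / x + c / y) * (D / x)) * (y0 * y / c) = y0 + (1 + c * (y / x)) * y0 * (D / x)"
    using assms x by (simp add: field_simps power2_eq_square)
  moreover have "(1 + c * (y / x)) * y0 * (D / x) \<le> (1 + c * 1) * y0 * (D / x)"
    using assms x by (intro mult_right_mono add_left_mono mult_left_mono) auto
  ultimately show ?thesis by simp
qed

text \<open>\<open>\<beta>\<close> is the largest coefficient with which the weak gain
  \<open>y\<close> meets the target, \<open>\<beta>0\<close> the smallest with which the strong gain
  \<open>x\<close> does; they agree when \<open>y = y0\<close>. Failure puts \<open>Acoef\<close> at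
  or above \<open>\<beta>\<close>, which bounds \<open>\<beta> - \<beta>0\<close> by
  \<open>D / x\<close>, and \<open>y - y0\<close> is proportional to this difference.\<close>

lemma weak_failure_thin:
  assumes "P > 0" "D > 0" "c / P \<le> y" "0 < x" "x \<le> x'" "y' \<le> y + D" "y' > 0" "c > 0"
    and fail: "P * y * (1 - Acoef P x' y') < c * (P * y * Acoef P x' y' + 1)"
    and full: "c / y0 = P - c * (1 + c) / x" and "y0 > 0" "y0 \<le> y"
  shows "y \<le> y0 + y * y0 * P * (1 + c) / c * (D / x)"
proof -
  have y: "y > 0" using assms(3) divide_pos_pos[OF \<open>c > 0\<close> \<open>P > 0\<close>] by linarith
  have Py: "c \<le> P * y" using assms by (simp add: field_simps)
  define \<beta> where "\<beta> = (P * y - c) / (P * y * (1 + c))"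
  define \<beta>0 where "\<beta>0 = c / (P * x)"
  have b: "c / y = P - P * (1 + c) * \<beta>" 
  proof -
    have "P * (1 + c) * \<beta> = (P * y - c) / y" unfolding \<beta>_def using \<open>P > 0\<close> \<open>c > 0\<close> y by simp
    then show ?thesis using y by (simp add: diff_divide_distrib)
  qed
  have b0: "c / y0 = P - P * (1 + c) * \<beta>0" unfolding full \<beta>0_def using assms by (simp add: field_simps)
  have bge0: "\<beta> \<ge> 0" unfolding \<beta>_def using Py assms y by simp
  have "c / y \<le> c / y0" using assms by (intro divide_left_mono) auto
  then have "P * (1 + c) * \<beta>0 \<le> P * (1 + c) * \<beta>" using b b0 by linarith
  then have bb: "\<beta>0 \<le> \<beta>" using assms by (auto simp: mult_le_cancel_left_pos)
  have "P * y - c < P * y * (1 + c) * Acoef P x' y'" using fail by (simp add: algebra_simps)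
  then have "\<beta> \<le> Acoef P x' y'" unfolding \<beta>_def using assms y by (simp add: pos_divide_le_eq mult_ac)
  then have "P * x' * \<beta>\<^sup>2 + (x' / y' + 1) * \<beta> \<le> 1"
    using assms bge0 by (intro Acoef_geD) auto
  moreover have "P * x * \<beta>\<^sup>2 + (x / (y + D) + 1) * \<beta> \<le> P * x' * \<beta>\<^sup>2 + (x' / y' + 1) * \<beta>"
    using assms bge0 by (intro add_mono mult_right_mono mult_left_mono frac_le) auto
  \<comment> \<open>In this form the right-hand side matches the quadratic term by term. As
    \<open>\<beta>0 \<le> \<beta>\<close>, the quadratic terms drop out and a comparison of the
    linear ones remains.\<close>
  moreover have "1 - \<beta> = P * x * \<beta> * \<beta>0 + \<beta>0 * x / y"
    using b assms y unfolding \<beta>0_def by (simp add: field_simps)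
  ultimately have "P * x * \<beta>\<^sup>2 + x / (y + D) * \<beta> \<le> P * x * \<beta> * \<beta>0 + \<beta>0 * x / y"
    by (simp add: algebra_simps)
  moreover have "P * x * \<beta> * \<beta>0 \<le> P * x * \<beta>\<^sup>2"
    using bb bge0 assms by (auto simp: power2_eq_square mult.assoc intro!: mult_left_mono)
  ultimately have "x / (y + D) * \<beta> \<le> \<beta>0 * x / y" by linarith
  then have "x * (\<beta> / (y + D)) \<le> x * (\<beta>0 / y)" by (simp add: mult_ac)
  then have "\<beta> / (y + D) \<le> \<beta>0 / y" using \<open>x > 0\<close> by (simp only: mult_le_cancel_left_pos)
  then have "\<beta> \<le> \<beta>0 * (y + D) / y" using \<open>D > 0\<close> y by (simp add: field_simps)
  also have "\<dots> = \<beta>0 + c / P / y * (D / x)" unfolding \<beta>0_def using y assms by (simp add: field_simps)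
  also have "\<dots> \<le> \<beta>0 + 1 * (D / x)"
    using assms y Py by (intro add_left_mono mult_right_mono) auto
  finally have bd: "\<beta> - \<beta>0 \<le> D / x" by simp
  have "y - y0 = y * y0 / c * (c / y0 - c / y)" using assms y by (simp add: field_simps)
  also have "\<dots> = y * y0 / c * (P * (1 + c) * (\<beta> - \<beta>0))" unfolding b b0 by (simp add: algebra_simps)
  also have "\<dots> \<le> y * y0 / c * (P * (1 + c) * (D / x))"
    using assms y bd by (intro mult_left_mono) auto
  also have "\<dots> = y * y0 * P * (1 + c) / c * (D / x)" by simp
  finally show ?thesis by linarith
qed

section \<open>Quantizer bounds and coarse failure\<close>

text \<open>\<open>T\<close> is real, so \<open>(T + 1) * D\<close> need not be a multiple of
  \<open>D\<close>. The strict bound still separates the overload value from all granular ones, so a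
  gain quantized at least as high as an overloaded one is overloaded too.\<close>

lemma qo_bounds:
  assumes "D > 0" "T \<ge> 0" "x > 0"
  shows qo_pos: "qo D T x > 0"
    and qo_upper: "qo D T x \<le> x + D"
    and qo_granular: "x \<le> T * D \<Longrightarrow> x \<le> qo D T x"
    and qo_granular_less: "x \<le> T * D \<Longrightarrow> qo D T x < (T + 1) * D"
    and qo_overload: "T * D < x \<Longrightarrow> qo D T x = (T + 1) * D"
proof -
  have 1: "\<lceil>x / D\<rceil> \<ge> 1" using assms by (simp add: one_le_ceiling)
  have c1: "real_of_int \<lceil>x / D\<rceil> * D \<le> (x / D + 1) * D" 
    using assms of_int_ceiling_le_add_one[of "x / D"] by (intro mult_right_mono) auto
  have c2: "x / D * D \<le> real_of_int \<lceil>x / D\<rceil> * D" 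
    using assms by (intro mult_right_mono) auto
  have c3: "real_of_int \<lceil>x / D\<rceil> * D < (x / D + 1) * D" 
    using assms ceiling_correct[of "x / D"] by (intro mult_strict_right_mono) linarith+
  show "qo D T x > 0" unfolding qo_def using 1 assms by auto
  show "qo D T x \<le> x + D" unfolding qo_def using c1 assms by (auto simp: algebra_simps)
  show "x \<le> qo D T x" if "x \<le> T * D" unfolding qo_def using c2 that assms by auto
  show "qo D T x < (T + 1) * D" if "x \<le> T * D"
    unfolding qo_def using c3 that assms by (auto simp: algebra_simps)
  show "qo D T x = (T + 1) * D" if "T * D < x" using that unfolding qo_def by auto
qed

text \<open>Whichever of \<open>B / m\<close> and \<open>B * D / m\<^sup>2\<close> dominates, which
  depends on whether \<open>m\<close> exceeds \<open>D\<close>, must be at least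
  \<open>P / 2\<close>.\<close>

lemma quadratic_le_linear_cases:
  fixes m P B D :: real
  assumes "P > 0" "m > 0" "B \<ge> 0" "D \<ge> 0" "P < B / m + B * D / m\<^sup>2"
  shows "m \<le> 2 * B / P \<or> m \<le> sqrt (2 * B) * sqrt (D / P)"
proof (cases "m \<le> D")
  case True
  have "P * m\<^sup>2 < (B / m + B * D / m\<^sup>2) * m\<^sup>2" using assms by (intro mult_strict_right_mono) auto
  also have "\<dots> = B * m + B * D" using assms by (simp add: field_simps power2_eq_square)
  also have "\<dots> \<le> 2 * B * D" using True assms mult_left_mono[OF True, of B] by simp
  finally have "m\<^sup>2 \<le> (2 * B) * (D / P)" using assms by (simp add: field_simps)
  then have "m \<le> sqrt ((2 * B) * (D / P))" by (rule real_le_rsqrt)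
  then show ?thesis unfolding real_sqrt_mult by blast
next
  case False
  have "P * m\<^sup>2 < (B / m + B * D / m\<^sup>2) * m\<^sup>2" using assms by (intro mult_strict_right_mono) auto
  also have "\<dots> = B * m + B * D" using assms by (simp add: field_simps power2_eq_square)
  also have "\<dots> \<le> 2 * B * m" using False assms mult_left_mono[of D m B] by simp
  finally have "P * m \<le> 2 * B" using assms by (simp add: power2_eq_square)
  then show ?thesis using assms by (simp add: field_simps)
qed

text \<open>With \<open>m\<close> the smaller gain, every ratio in
  \<open>strong_failure_bound\<close> is controlled by \<open>1 + D / m\<close> and
  \<open>1 / m\<close>, which gives the inequality of
  \<open>quadratic_le_linear_cases\<close>.\<close>

lemma strong_failure_coarse:
  assumes "P > 0" "D > 0" "T \<ge> 0" "c > 0" "x > 0" "y > 0" "qo D T y \<le> qo D T x"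
    and "P * Acoef P (qo D T x) (qo D T y) * x < c"
  defines "B \<equiv> c\<^sup>2 + 2 * c"
  shows "min x y \<le> 2 * B / P \<or> min x y \<le> sqrt (2 * B) * sqrt (D / P)"
proof -
  define x' y' m where "x' = qo D T x" and "y' = qo D T y" and "m = min x y"
  have x': "x' > 0" "x' \<le> x + D" and y': "y' > 0" "y' \<le> x'"
    unfolding x'_def y'_def using qo_pos qo_upper assms by auto
  have m: "m > 0" "m \<le> x" "m \<le> y" unfolding m_def using assms by auto
  have b1: "P < c\<^sup>2 * x' / x\<^sup>2 + (x' / y' + 1) * c / x"
    by (rule strong_failure_bound) (use assms x' y' in \<open>auto simp: x'_def y'_def\<close>)
  have xm: "x' / x \<le> 1 + D / m"
  proof -
    have "x' / x \<le> (x + D) / x" using x' assms by (intro divide_right_mono) auto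
    also have "\<dots> = 1 + D / x" using assms by (simp add: field_simps)
    also have "\<dots> \<le> 1 + D / m" using assms m by (intro add_left_mono divide_left_mono) auto
    finally show ?thesis .
  qed
  have t1: "c\<^sup>2 * x' / x\<^sup>2 \<le> c\<^sup>2 * (1 + D / m) / m"
  proof -
    have "c\<^sup>2 * x' / x\<^sup>2 = c\<^sup>2 * (x' / x) / x" by (simp add: power2_eq_square)
    also have "\<dots> \<le> c\<^sup>2 * (1 + D / m) / m"
      using m xm assms x' by (intro frac_le mult_left_mono mult_nonneg_nonneg) auto
    finally show ?thesis .
  qed
  have t2: "x' / y' * (c / x) \<le> (1 + D / m) * c / m"
  \<comment> \<open>A granular \<open>y\<close> has \<open>y'\<close> at least \<open>m\<close>. An
    overloaded \<open>y\<close> forces \<open>x\<close> to be overloaded as well, and then the ratio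
    is 1.\<close>
  proof (cases "y \<le> T * D")
    case True
    then have "y \<le> y'" unfolding y'_def using assms qo_granular by auto
    have "x' / y' * (c / x) = x' / x * (c / y')" by simp
    also have "\<dots> \<le> (1 + D / m) * (c / m)"
      using m xm assms x' y' \<open>y \<le> y'\<close> by (intro mult_mono frac_le) auto
    finally show ?thesis by simp
  next
    case False
    then have "x' = y'" using assms y' qo_overload[of D T y] qo_overload[of D T x] qo_granular_less[of D T x]
      unfolding x'_def y'_def by force
    then have "x' / y' * (c / x) = 1 * (c / x)" using x' by simp
    also have "\<dots> \<le> (1 + D / m) * (c / m)"
      using m assms x' y' by (intro mult_mono frac_le) auto
    finally show ?thesis by simp
  qed
  have t3: "c / x \<le> c / m" using m assms by (intro divide_left_mono) auto
  have "P < c\<^sup>2 * (1 + D / m) / m + (1 + D / m) * c / m + c / m"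
    using b1 t1 t2 t3 by (simp add: add_divide_distrib distrib_right)
  also have "\<dots> = (c\<^sup>2 + 2 * c) / m + (c\<^sup>2 + c) * D / m\<^sup>2"
    using m by (simp add: field_simps power2_eq_square)
  also have "\<dots> \<le> (c\<^sup>2 + 2 * c) / m + (c\<^sup>2 + 2 * c) * D / m\<^sup>2"
    using m assms by (intro add_left_mono divide_right_mono mult_right_mono) auto
  finally show ?thesis
    using assms m unfolding m_def[symmetric] B_def by (intro quadratic_le_linear_cases) auto
qed

section \<open>Covering the loss event\<close>

text \<open>The conditions on \<open>(a, b)\<close>, with \<open>a\<close> held fixed, correspond to the ways in which a loss can occur:
  \<open>b\<close> is so weak that quantization errs by a large factor; \<open>b\<close> is weak while \<open>a\<close> is overloaded or
  unusually small; the two quantized gains tie; or \<open>b\<close> is close to the boundary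
  \<open>c / (P - c (1 + c) / a)\<close> of the full-CSI outage region.\<close>

definition loss_cover :: "real \<Rightarrow> real \<Rightarrow> real \<Rightarrow> real \<Rightarrow> real \<Rightarrow> real \<Rightarrow> (real \<times> real) set" where
  "loss_cover c K K' P D M = {(a, b). c / P \<le> a \<and> c / P \<le> b \<and>
     (b \<le> K * sqrt (D / P) \<or> (M < a \<or> a \<le> sqrt D) \<and> b \<le> K / P \<or> a \<le> K / P \<and> \<bar>b - a\<bar> \<le> D \<or>
      c / (P - c * (1 + c) / a) \<le> b \<and> b \<le> c / (P - c * (1 + c) / a) + K' * sqrt D / P)}"

text \<open>The two summands of the constant come from the strong and the weak failure. The weak one
  carries \<open>y * y0 * P\<close>, at most \<open>K\<^sup>2 / P\<close>, hence the square.\<close>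

lemma loss_cover_granular:
  assumes "P > 0" "D > 0" "T \<ge> 0" "c > 0" "y > 0" "y \<le> x" "x \<le> T * D"
    and full: "c / y + c * (1 + c) / x \<le> P"
    and fail: "P * Acoef P (qo D T x) (qo D T y) * x < c \<or>
      P * y * (1 - Acoef P (qo D T x) (qo D T y)) < c * (P * y * Acoef P (qo D T x) (qo D T y) + 1)"
    and "sqrt D \<le> x" "y \<le> K / P"
  defines "y0 \<equiv> c / (P - c * (1 + c) / x)"
  shows "y0 \<le> y \<and> y \<le> y0 + ((1 + c) * K + (1 + c) * K\<^sup>2 / c) * sqrt D / P"
proof -
  have x: "x > 0" using assms by auto
  have "c / y > 0" using assms by simp
  then have pos: "P - c * (1 + c) / x > 0" using full by linarith
  have y0: "y0 > 0" "c / y0 = P - c * (1 + c) / x" using pos assms unfolding y0_def by auto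
  have "c / y \<le> c / y0" using full y0 by linarith
  then have y0y: "y0 \<le> y"
    using y0(1) \<open>c > 0\<close> \<open>y > 0\<close> by (simp add: divide_le_eq pos_le_divide_eq mult.commute)
  have q: "x \<le> qo D T x" "y \<le> qo D T y" "qo D T x \<le> x + D" "qo D T y \<le> y + D" "qo D T y > 0"
    using assms x qo_granular qo_upper qo_pos by auto
  have "c * (1 + c) / x \<ge> 0" using assms x by simp
  then have "c / y \<le> P" using full by linarith
  then have cPy: "c / P \<le> y" using assms by (simp add: field_simps)
  have K: "K > 0" using assms by (smt (verit) divide_pos_pos zero_less_divide_iff)
  \<comment> \<open>Keeping \<open>x\<close> above \<open>sqrt D\<close> turns the relative error
    \<open>D / x\<close> into \<open>sqrt D\<close>.\<close>
  have "D = sqrt D * sqrt D" using assms by simp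
  also have "\<dots> \<le> sqrt D * x" using assms by (intro mult_left_mono) auto
  finally have Dx: "D / x \<le> sqrt D" using x by (simp add: field_simps)
  have split: "((1 + c) * K + (1 + c) * K\<^sup>2 / c) * sqrt D / P
      = (1 + c) * K * sqrt D / P + (1 + c) * K\<^sup>2 / c * sqrt D / P"
    by (simp add: algebra_simps add_divide_distrib)
  have nn: "(1 + c) * K * sqrt D / P \<ge> 0" "(1 + c) * K\<^sup>2 / c * sqrt D / P \<ge> 0"
    using assms K by auto
  show ?thesis
  proof (intro conjI y0y, use fail in \<open>elim disjE\<close>)
    assume f: "P * Acoef P (qo D T x) (qo D T y) * x < c"
    have "y \<le> y0 + (1 + c) * y0 * (D / x)"
      by (rule strong_failure_thin[OF \<open>P > 0\<close> \<open>D > 0\<close> \<open>y > 0\<close> \<open>y \<le> x\<close> q(1,3,2) \<open>c > 0\<close> f y0(2,1)])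
    moreover have "(1 + c) * y0 * (D / x) \<le> (1 + c) * (K / P) * sqrt D"
      using y0y y0 Dx assms x K by (intro mult_mono) auto
    ultimately show "y \<le> y0 + ((1 + c) * K + (1 + c) * K\<^sup>2 / c) * sqrt D / P"
      using split nn by simp
  next
    assume f: "P * y * (1 - Acoef P (qo D T x) (qo D T y)) < c * (P * y * Acoef P (qo D T x) (qo D T y) + 1)"
    have "y \<le> y0 + y * y0 * P * (1 + c) / c * (D / x)"
      by (rule weak_failure_thin[OF \<open>P > 0\<close> \<open>D > 0\<close> cPy x q(1,4,5) \<open>c > 0\<close> f y0(2,1) y0y])
    moreover have "y * y0 * P * (1 + c) / c * (D / x) \<le> (K / P) * (K / P) * P * (1 + c) / c * sqrt D"
      using y0y y0 Dx assms x K by (intro mult_mono divide_right_mono) auto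
    moreover have "(K / P) * (K / P) * P * (1 + c) / c * sqrt D = (1 + c) * K\<^sup>2 / c * sqrt D / P"
      using assms by (simp add: field_simps power2_eq_square)
    ultimately show "y \<le> y0 + ((1 + c) * K + (1 + c) * K\<^sup>2 / c) * sqrt D / P"
      using split nn by simp
  qed
qed

text \<open>The roles follow the quantized gains, whose order may differ from that of the true gains
  after a tie or overload; hence \<open>min\<close> and \<open>max\<close> in the full-CSI
  condition. \<open>K\<close> is chosen to dominate \<open>1 + 2 * B\<close> and the constants
  \<open>4 * c\<close> and \<open>16 * c\<^sup>2\<close> of the coarse weak failure.\<close>

lemma loss_covered:
  assumes "P > 0" "D > 0" "T \<ge> 0" "c > 0" "x > 0" "y > 0" and ord: "qo D T y \<le> qo D T x"
    and full: "c / min x y + c * (1 + c) / max x y \<le> P"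
    and fail: "P * Acoef P (qo D T x) (qo D T y) * x < c \<or>
      P * y * (1 - Acoef P (qo D T x) (qo D T y)) < c * (P * y * Acoef P (qo D T x) (qo D T y) + 1)"
  defines "K \<equiv> 1 + 18 * c\<^sup>2 + 4 * c"
  defines "K' \<equiv> (1 + c) * K + (1 + c) * K\<^sup>2 / c"
  shows "(x, y) \<in> loss_cover c K K' P D (T * D) \<or> (y, x) \<in> loss_cover c K K' P D (T * D) \<or>
    (T * D < x \<and> T * D < y \<and> c / P \<le> x \<and> c / P \<le> y \<and> D \<le> K / P)"
proof -
  define m where "m = min x y"
  define B where "B = c\<^sup>2 + 2 * c"
  have m: "m > 0" "m \<le> x" "m \<le> y" unfolding m_def using assms by auto
  have "c * (1 + c) / max x y \<ge> 0" using assms by simp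
  then have "c / m \<le> P" using full unfolding m_def by linarith
  then have "c / P \<le> m" using m assms by (simp add: field_simps)
  then have lo: "c / P \<le> x" "c / P \<le> y" using m by auto
  have B0: "B \<ge> 0" unfolding B_def using assms by simp
  have KB: "2 * B \<le> K" "4 * c \<le> K" "16 * c\<^sup>2 \<le> K" "K > 0" unfolding K_def B_def using assms by (auto simp: add_pos_pos)
  have "2 * B \<le> (1 + 2 * B)\<^sup>2" using B0 by (simp add: power2_eq_square algebra_simps)
  then have "sqrt (2 * B) \<le> 1 + 2 * B" using B0 by (intro real_le_lsqrt) auto
  also have "\<dots> \<le> K" unfolding K_def B_def using assms by simp
  finally have KB': "sqrt (2 * B) \<le> K" .
  have KP: "2 * B / P \<le> K / P" "4 * c / P \<le> K / P" "16 * c\<^sup>2 / P \<le> K / P"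
    using KB assms by (auto intro!: divide_right_mono)
  have KS: "sqrt (2 * B) * sqrt (D / P) \<le> K * sqrt (D / P)"
    using KB' assms by (intro mult_right_mono) auto
  have coarse: "m \<le> K / P \<or> m \<le> K * sqrt (D / P) \<or> (T * D < x \<and> T * D < y \<and> D \<le> K / P)"
    using fail
  proof
    assume f: "P * Acoef P (qo D T x) (qo D T y) * x < c"
    have "m \<le> 2 * B / P \<or> m \<le> sqrt (2 * B) * sqrt (D / P)"
      unfolding m_def B_def by (rule strong_failure_coarse) (use assms f in auto)
    then show ?thesis using KP KS by linarith
  next
    assume f: "P * y * (1 - Acoef P (qo D T x) (qo D T y)) < c * (P * y * Acoef P (qo D T x) (qo D T y) + 1)"
    have "y \<le> 4 * c / P \<or> qo D T x \<le> 16 * c\<^sup>2 / P"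
      by (rule weak_failure_coarse[of _ _ "qo D T y"]) (use assms f qo_pos in auto)
    then show ?thesis
    proof
      assume "y \<le> 4 * c / P"
      then show ?thesis using m KP by linarith
    next
      assume q: "qo D T x \<le> 16 * c\<^sup>2 / P"
      show ?thesis
      proof (cases "y \<le> T * D")
        case True
        then have "y \<le> qo D T y" using assms qo_granular by auto
        then show ?thesis using ord q m KP by linarith
      next
        case False
        then have yq: "qo D T y = (T + 1) * D" using assms qo_overload by auto
        \<comment> \<open>Both gains are overloaded, and the small common quantized value
          \<open>(T + 1) * D\<close> bounds \<open>D\<close> itself.\<close>
        have x: "x > T * D" using qo_granular_less[of D T x] assms(2,3,5) ord yq by force
        have "D \<le> (T + 1) * D" using assms by (simp add: algebra_simps)
        then show ?thesis using x False yq ord q KP by linarith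
      qed
    qed
  qed
  then consider (big) "T * D < x \<and> T * D < y \<and> D \<le> K / P"
    | (sq) "m \<le> K * sqrt (D / P)" | (lin) "m \<le> K / P" by blast
  then show ?thesis
  proof cases
    case big then show ?thesis using lo by auto
  next
    case sq
    then show ?thesis using lo unfolding loss_cover_def m_def by (cases "x \<le> y") auto
  next
    case lin
    show ?thesis
    proof (cases "y \<le> x")
      case True
      then have yK: "y \<le> K / P" using lin m_def by auto
      show ?thesis
      proof (cases "T * D < x \<or> x \<le> sqrt D")
        case True
        then show ?thesis using lo yK unfolding loss_cover_def by auto
      next
        case False
        have "c / (P - c * (1 + c) / x) \<le> y \<and> y \<le> c / (P - c * (1 + c) / x) + K' * sqrt D / P"
          unfolding K'_def
          by (rule loss_cover_granular[where T = T])
            (use assms False \<open>y \<le> x\<close> yK in \<open>auto simp: min_absorb2 max_absorb1\<close>)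
        then show ?thesis using lo unfolding loss_cover_def by auto
      qed
    next
      \<comment> \<open>Here the true order is the reverse of the quantized one. Either
        \<open>y\<close> is overloaded, giving a swapped member of the cover, or both gains lie
        within one quantization step.\<close>
      case False
      then have xK: "x \<le> K / P" using lin m_def by auto
      show ?thesis
      proof (cases "T * D < y")
        case True
        then show ?thesis using lo xK unfolding loss_cover_def by auto
      next
        case gran: False
        then have "y \<le> qo D T y" using assms qo_granular by auto
        also have "\<dots> \<le> x + D" using ord qo_upper[of D T x] assms(2,3,5) by linarith
        finally have "\<bar>y - x\<bar> \<le> D" using False by auto
        then show ?thesis using lo xK unfolding loss_cover_def by auto
      qed
    qed
  qed
qed

lemma log2_one_plus_less_iff:
  assumes "z > -1" shows "log 2 (1 + z) < r \<longleftrightarrow> z < 2 powr r - 1"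
proof -
  have "log 2 (1 + z) < r \<longleftrightarrow> 1 + z < 2 powr r" using assms by (intro log_less_iff) auto
  then show ?thesis by auto
qed

lemma loss_event_covered:
  assumes "P > 0" "D > 0" "T \<ge> 0" "rth > 0" "h1 > 0" "h2 > 0"
    and full: "\<not> rmax P h1 h2 < rth" and fail: "rq P D T h1 h2 < rth"
  defines "c \<equiv> 2 powr rth - 1"
  defines "K \<equiv> 1 + 18 * c\<^sup>2 + 4 * c"
  defines "K' \<equiv> (1 + c) * K + (1 + c) * K\<^sup>2 / c"
  shows "(h1, h2) \<in> loss_cover c K K' P D (T * D) \<or> (h2, h1) \<in> loss_cover c K K' P D (T * D) \<or>
    (T * D < h1 \<and> T * D < h2 \<and> c / P \<le> h1 \<and> c / P \<le> h2 \<and> D \<le> K / P)"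
proof -
  have c: "c > 0" unfolding c_def using assms powr_less_mono[of 0 rth 2] by simp
  have f: "c / min h1 h2 + c * (1 + c) / max h1 h2 \<le> P"
  proof -
    have rm: "rmax P h1 h2 = log 2 (1 + P * max h1 h2 * Acoef P (max h1 h2) (min h1 h2))"
      unfolding rmax_def by (auto simp: max_def min_def)
    have A: "P * max h1 h2 * Acoef P (max h1 h2) (min h1 h2) > 0"
      using assms by (intro mult_pos_pos Acoef_pos) auto
    have "\<not> P * max h1 h2 * Acoef P (max h1 h2) (min h1 h2) < c"
      using full log2_one_plus_less_iff[of "P * max h1 h2 * Acoef P (max h1 h2) (min h1 h2)" rth] A
      unfolding rm c_def by auto
    then show ?thesis using assms c by (intro full_csi_feasible) auto
  qed
  \<comment> \<open>Stated for generic gains so that it serves both orders.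
    \<open>y' \<le> x'\<close> keeps the coefficient at most 1/2, so the logarithms have positive
    arguments.\<close>
  have fl: "P * Acoef P x' y' * x < c \<or> P * y * (1 - Acoef P x' y') < c * (P * y * Acoef P x' y' + 1)"
    if "min (Rstrong P (Acoef P x' y') x) (Rweak P (Acoef P x' y') y) < rth" "x > 0" "y > 0"
      "y' > 0" "y' \<le> x'" for x y x' y'
  proof -
    let ?A = "Acoef P x' y'"
    have A: "?A > 0" "?A \<le> 1/2" using that assms Acoef_pos[of P x' y'] Acoef_le_half[of P x' y'] by auto
    have d: "P * y * ?A + 1 > 0" using A that assms by (simp add: add_pos_pos)
    have "P * ?A * x > 0" using A that assms by simp
    then have s: "Rstrong P ?A x < rth \<longleftrightarrow> P * ?A * x < c"
      unfolding Rstrong_def c_def by (intro log2_one_plus_less_iff) auto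
    have "P * y * (1 - ?A) / (P * y * ?A + 1) \<ge> 0" using A that assms d by simp
    then have "Rweak P ?A y < rth \<longleftrightarrow> P * y * (1 - ?A) / (P * y * ?A + 1) < c"
      unfolding Rweak_def c_def by (intro log2_one_plus_less_iff) auto
    also have "\<dots> \<longleftrightarrow> P * y * (1 - ?A) < c * (P * y * ?A + 1)" using d by (simp add: pos_divide_less_eq)
    finally show ?thesis using s that by (auto simp: min_less_iff_disj)
  qed
  have q: "qo D T h1 > 0" "qo D T h2 > 0" using assms qo_pos by auto
  show ?thesis
  proof (cases "qo D T h2 \<le> qo D T h1")
    case True
    then have "min (Rstrong P (Acoef P (qo D T h1) (qo D T h2)) h1) (Rweak P (Acoef P (qo D T h1) (qo D T h2)) h2) < rth"
      using fail q unfolding rq_def alpha_q_def by (simp add: Let_def)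
    from fl[OF this \<open>h1 > 0\<close> \<open>h2 > 0\<close> q(2) True]
    show ?thesis unfolding K_def K'_def using assms(1-6) c True f by (intro loss_covered) auto
  next
    case False
    then have le: "qo D T h1 \<le> qo D T h2" by simp
    have "min (Rstrong P (Acoef P (qo D T h2) (qo D T h1)) h2) (Rweak P (Acoef P (qo D T h2) (qo D T h1)) h1) < rth"
      using fail q False unfolding rq_def alpha_q_def by (simp add: Let_def min.commute)
    from fl[OF this \<open>h2 > 0\<close> \<open>h1 > 0\<close> q(1) le]
    have "(h2, h1) \<in> loss_cover c K K' P D (T * D) \<or> (h1, h2) \<in> loss_cover c K K' P D (T * D) \<or>
    (T * D < h2 \<and> T * D < h1 \<and> c / P \<le> h2 \<and> c / P \<le> h1 \<and> D \<le> K / P)"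
      unfolding K_def K'_def using assms(1-6) c le f
      by (intro loss_covered) (auto simp: min.commute max.commute)
    then show ?thesis by auto
  qed
qed

section \<open>The exponential law and the channel measure\<close>

abbreviation exp_law :: "real \<Rightarrow> real measure" where
  "exp_law \<kappa> \<equiv> density lborel (exponential_density (1 / \<kappa>))"

lemma prob_space_exp_law: "\<kappa> > 0 \<Longrightarrow> prob_space (exp_law \<kappa>)"
  by (intro prob_space_exponential_density) simp

lemma exp_law_distributed:
  assumes "\<kappa> > 0"
  shows "distributed (exp_law \<kappa>) lborel (\<lambda>x. x) (exponential_density (1 / \<kappa>))"
  unfolding distributed_def
proof (intro conjI)
  have "distr (exp_law \<kappa>) lborel (\<lambda>x. x) = distr (exp_law \<kappa>) (exp_law \<kappa>) (\<lambda>x. x)"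
    by (intro distr_cong) auto
  then show "distr (exp_law \<kappa>) lborel (\<lambda>x. x) = exp_law \<kappa>" by simp
qed (use assms in \<open>auto simp: exponential_density_nonneg\<close>)

text \<open>On \<open>{u..}\<close> the density is at most \<open>exp (- u / L) / l\<close>. The
  window position \<open>v\<close> is independent of \<open>u\<close>, so it may move with the other
  gain while \<open>u = c / P\<close> supplies the exponential factor. The bracket \<open>l\<close>,
  \<open>L\<close> around the mean makes one bound serve both receivers.\<close>

lemma exp_law_interval:
  assumes "0 < l" "l \<le> \<kappa>" "\<kappa> \<le> L" "0 \<le> u" "0 \<le> d" "A \<subseteq> {u..}" "A \<subseteq> {v..v + d}" "A \<in> sets borel"
  shows "measure (exp_law \<kappa>) A \<le> d / l * exp (- u / L)"
proof -
  let ?K = "1 / l * exp (- u / L)"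
  have K0: "?K \<ge> 0" using assms by simp
  have b: "exponential_density (1 / \<kappa>) x \<le> ?K" if "x \<in> A" for x
  proof -
    have x: "x \<ge> u" using that assms by auto
    have "u / L \<le> x / \<kappa>" using x assms by (intro frac_le) auto
    then have "1 / \<kappa> * exp (- x / \<kappa>) \<le> ?K" using assms by (intro mult_mono frac_le) auto
    then show ?thesis using x assms by (simp add: exponential_density_def)
  qed
  have "emeasure (exp_law \<kappa>) A = (\<integral>\<^sup>+ x. ennreal (exponential_density (1 / \<kappa>) x) * indicator A x \<partial>lborel)"
    using assms by (intro emeasure_density) auto
  also have "\<dots> \<le> (\<integral>\<^sup>+ x. ennreal ?K * indicator {v..v + d} x \<partial>lborel)"
    using assms b K0 by (intro nn_integral_mono) (auto simp: indicator_def intro!: ennreal_leI)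
  also have "\<dots> = ennreal ?K * ennreal d"
    using assms by (simp add: nn_integral_cmult_indicator)
  also have "\<dots> = ennreal (d / l * exp (- u / L))"
    using assms K0 by (subst ennreal_mult[symmetric]) (auto simp: mult_ac)
  finally have *: "emeasure (exp_law \<kappa>) A \<le> ennreal (d / l * exp (- u / L))" .
  have "d / l * exp (- u / L) \<ge> 0" using assms by simp
  then show ?thesis using * by (simp add: measure_def enn2real_leI)
qed

lemma exp_law_tail:
  assumes "0 < \<kappa>" "\<kappa> \<le> L" "0 \<le> a"
  shows "measure (exp_law \<kappa>) {a..} \<le> exp (- a / L)"
proof -
  interpret prob_space "exp_law \<kappa>" by (rule prob_space_exp_law) fact
  \<comment> \<open>A window of length zero shows that there is no atom, so open and closed tails
    agree.\<close>
  have "measure (exp_law \<kappa>) {a} \<le> 0 / \<kappa> * exp (- a / \<kappa>)"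
    using assms by (intro exp_law_interval[where v = a]) auto
  then have 0: "measure (exp_law \<kappa>) {a} \<le> 0" by simp
  have "\<P>(x in exp_law \<kappa>. a < x) = exp (- a * (1 / \<kappa>))"
    using assms by (intro exponential_distributedD_gt exp_law_distributed) auto
  moreover have "{x \<in> space (exp_law \<kappa>). a < x} = {a<..}" by auto
  ultimately have gt: "measure (exp_law \<kappa>) {a<..} = exp (- a / \<kappa>)" by simp
  have "{a..} = {a} \<union> {a<..}" by auto
  then have "measure (exp_law \<kappa>) {a..} \<le> measure (exp_law \<kappa>) {a} + measure (exp_law \<kappa>) {a<..}"
    by (simp only:) (rule measure_Un_le, auto)
  also have "\<dots> \<le> exp (- a / \<kappa>)" using 0 gt by simp
  also have "\<dots> \<le> exp (- a / L)" using assms by (auto intro!: divide_left_mono)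
  finally show ?thesis .
qed

lemma exp_law_nonpos:
  assumes "0 < \<kappa>" shows "measure (exp_law \<kappa>) {..0} = 0"
proof -
  interpret prob_space "exp_law \<kappa>" by (rule prob_space_exp_law) fact
  have "\<P>(x in exp_law \<kappa>. x \<le> 0) = 1 - exp (- 0 * (1 / \<kappa>))"
    using assms by (intro exponential_distributedD_le exp_law_distributed) auto
  moreover have "{x \<in> space (exp_law \<kappa>). x \<le> 0} = {..0}" by auto
  ultimately show ?thesis by simp
qed

text \<open>Tonelli with a uniform slice bound: one coordinate contributes a short window, the other
  the probability of the base \<open>B\<close>.\<close>

lemma measure_pair_le_slices:
  assumes "prob_space M1" "prob_space M2" "S \<in> sets (M1 \<Otimes>\<^sub>M M2)" "B \<in> sets M1" "0 \<le> K"
    and "\<And>a. a \<in> B \<Longrightarrow> measure M2 (Pair a -` S) \<le> K" "\<And>a b. (a, b) \<in> S \<Longrightarrow> a \<in> B"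
  shows "measure (M1 \<Otimes>\<^sub>M M2) S \<le> K * measure M1 B"
proof -
  interpret M1: prob_space M1 by fact
  interpret M2: prob_space M2 by fact
  have "emeasure (M1 \<Otimes>\<^sub>M M2) S = (\<integral>\<^sup>+ a. emeasure M2 (Pair a -` S) \<partial>M1)"
    using assms by (intro M2.emeasure_pair_measure_alt)
  also have "\<dots> \<le> (\<integral>\<^sup>+ a. ennreal K * indicator B a \<partial>M1)"
  proof (intro nn_integral_mono)
    fix a assume "a \<in> space M1"
    show "emeasure M2 (Pair a -` S) \<le> ennreal K * indicator B a"
    proof (cases "a \<in> B")
      case True
      then show ?thesis using assms(6)[OF True] by (simp add: M2.emeasure_eq_measure ennreal_leI)
    next
      case False
      then have "Pair a -` S = {}" using assms(7) by auto
      then show ?thesis by simp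
    qed
  qed
  also have "\<dots> = ennreal (K * measure M1 B)"
    using assms by (simp add: nn_integral_cmult_indicator M1.emeasure_eq_measure ennreal_mult)
  finally show ?thesis using assms by (simp add: measure_def enn2real_leI)
qed

lemma sets_chanM [measurable_cong]: "sets (chanM \<kappa> \<mu>) = sets (borel \<Otimes>\<^sub>M borel)"
  unfolding chanM_def by (intro sets_pair_measure_cong) auto

lemma space_chanM [simp]: "space (chanM \<kappa> \<mu>) = UNIV"
  unfolding chanM_def by (simp add: space_pair_measure)

lemma prob_space_chanM: "\<kappa> > 0 \<Longrightarrow> \<mu> > 0 \<Longrightarrow> prob_space (chanM \<kappa> \<mu>)"
  unfolding chanM_def by (intro prob_space_pair prob_space_exp_law)

lemma chanM_slices:
  assumes "\<kappa> > 0" "\<mu> > 0" "S \<in> sets (borel \<Otimes>\<^sub>M borel)" "B \<in> sets borel" "0 \<le> K"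
    and "\<And>a. a \<in> B \<Longrightarrow> measure (exp_law \<mu>) (Pair a -` S) \<le> K" "\<And>a b. (a, b) \<in> S \<Longrightarrow> a \<in> B"
  shows "measure (chanM \<kappa> \<mu>) S \<le> K * measure (exp_law \<kappa>) B"
  using assms sets_chanM unfolding chanM_def
  by (intro measure_pair_le_slices prob_space_exp_law) auto

text \<open>The cover also occurs with its coordinates exchanged; this reduces that case to
  exchanged means.\<close>

lemma chanM_swap:
  assumes "\<kappa> > 0" "\<mu> > 0" "S \<in> sets (borel \<Otimes>\<^sub>M borel)"
  shows "measure (chanM \<kappa> \<mu>) {h. (snd h, fst h) \<in> S} = measure (chanM \<mu> \<kappa>) S"
proof -
  interpret A: prob_space "exp_law \<kappa>" by (rule prob_space_exp_law) fact
  interpret B: prob_space "exp_law \<mu>" by (rule prob_space_exp_law) fact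
  interpret pair_sigma_finite "exp_law \<mu>" "exp_law \<kappa>" ..
  have "measure (chanM \<mu> \<kappa>) S = measure (distr (chanM \<kappa> \<mu>) (chanM \<mu> \<kappa>) (\<lambda>(x, y). (y, x))) S"
    unfolding chanM_def by (subst distr_pair_swap) simp
  also have "\<dots> = measure (chanM \<kappa> \<mu>) ((\<lambda>(x, y). (y, x)) -` S \<inter> space (chanM \<kappa> \<mu>))"
    using assms sets_chanM unfolding chanM_def by (intro measure_distr measurable_pair_swap') auto
  also have "(\<lambda>(x, y). (y, x)) -` S \<inter> space (chanM \<kappa> \<mu>) = {h. (snd h, fst h) \<in> S}" by auto
  finally show ?thesis by simp
qed

section \<open>Probability of the covering sets\<close>

lemma sets_loss_cover: "loss_cover c K K' P D M \<in> sets (borel \<Otimes>\<^sub>M borel)"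
proof -
  have "loss_cover c K K' P D M = {h \<in> space (borel \<Otimes>\<^sub>M borel). c / P \<le> fst h \<and> c / P \<le> snd h \<and>
     (snd h \<le> K * sqrt (D / P) \<or> (M < fst h \<or> fst h \<le> sqrt D) \<and> snd h \<le> K / P \<or>
      fst h \<le> K / P \<and> \<bar>snd h - fst h\<bar> \<le> D \<or>
      c / (P - c * (1 + c) / fst h) \<le> snd h \<and> snd h \<le> c / (P - c * (1 + c) / fst h) + K' * sqrt D / P)}"
    unfolding loss_cover_def by (simp add: space_pair_measure case_prod_unfold)
  also have "\<dots> \<in> sets (borel \<Otimes>\<^sub>M borel)" by measurable
  finally show ?thesis .
qed

text \<open>This explains the choice of \<open>T\<close>: overload under an exponential law of mean
  \<open>L\<close> has probability exactly \<open>sqrt D\<close>.\<close>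

lemma exp_threshold_eq_sqrt:
  fixes D L :: real
  assumes "0 < D" "0 < L"
  shows "exp (- (L / 2 * ln (1 / D)) / L) = sqrt D"
proof -
  have "- (L / 2 * ln (1 / D)) / L = ln (sqrt D)" using assms by (simp add: ln_div ln_sqrt)
  then show ?thesis using assms by simp
qed

lemma measure_loss_cover:
  assumes "0 < l" "l \<le> \<kappa>" "\<kappa> \<le> L" "l \<le> \<mu>" "\<mu> \<le> L" "P > 0" "0 < D" "D \<le> 1" "0 < c" "0 < K" "0 < K'"
    and M: "M = L / 2 * ln (1 / D)"
  shows "measure (chanM \<kappa> \<mu>) (loss_cover c K K' P D M)
    \<le> (K / l + K / l * (1 + 1 / l) + 2 * K / l\<^sup>2 + K' / l) * exp (- c / P / L) * ((1 + sqrt P) / P) * sqrt D"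
proof -
  interpret prob_space "chanM \<kappa> \<mu>" using assms by (intro prob_space_chanM) auto
  interpret L: prob_space "exp_law \<kappa>" using assms by (intro prob_space_exp_law) auto
  let ?G = "exp (- (c / P) / L)" and ?W = "(1 + sqrt P) / P"
  have pos: "c / P > 0" "\<kappa> > 0" "\<mu> > 0" using assms by auto
  have nn: "0 \<le> x" if "c / P \<le> x" for x using that pos by linarith
  \<comment> \<open>\<open>?W\<close> is the sum of \<open>1 / P\<close> and
    \<open>1 / sqrt P\<close>. Only \<open>S1\<close> needs the second summand.\<close>
  have W: "1 / sqrt P \<le> ?W" "1 / P \<le> ?W"
    using assms by (auto simp: field_simps) 
  have sD: "D \<le> sqrt D" using assms by (intro real_le_rsqrt) (simp add: power2_eq_square mult_left_le)
  have M0: "M \<ge> 0" unfolding M using assms by (intro mult_nonneg_nonneg ln_ge_zero) auto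
  have eM: "exp (- M / L) = sqrt D" unfolding M using assms by (intro exp_threshold_eq_sqrt) auto
  \<comment> \<open>One set per disjunct of the cover; each yields one summand of the
    constant.\<close>
  define S1 where "S1 = {h :: real \<times> real. c / P \<le> snd h \<and> snd h \<le> K * sqrt (D / P)}"
  define S2 where "S2 = {h :: real \<times> real. c / P \<le> fst h \<and> c / P \<le> snd h \<and> (M < fst h \<or> fst h \<le> sqrt D) \<and> snd h \<le> K / P}"
  define S3 where "S3 = {h :: real \<times> real. c / P \<le> fst h \<and> c / P \<le> snd h \<and> fst h \<le> K / P \<and> \<bar>snd h - fst h\<bar> \<le> D}"
  define S4 where "S4 = {h :: real \<times> real. c / P \<le> snd h \<and>
     c / (P - c * (1 + c) / fst h) \<le> snd h \<and> snd h \<le> c / (P - c * (1 + c) / fst h) + K' * sqrt D / P}"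
  have coll: "{h. Q h} \<in> sets (borel \<Otimes>\<^sub>M borel)" if "{h \<in> space (borel \<Otimes>\<^sub>M borel). Q h} \<in> sets (borel \<Otimes>\<^sub>M borel)"
    for Q :: "real \<times> real \<Rightarrow> bool" using that by (simp add: space_pair_measure)
  have sets: "S1 \<in> sets (borel \<Otimes>\<^sub>M borel)" "S2 \<in> sets (borel \<Otimes>\<^sub>M borel)"
    "S3 \<in> sets (borel \<Otimes>\<^sub>M borel)" "S4 \<in> sets (borel \<Otimes>\<^sub>M borel)"
    unfolding S1_def S2_def S3_def S4_def by (rule coll; measurable)+
  have slice: "Pair a -` S \<in> sets borel" if "S \<in> sets (borel \<Otimes>\<^sub>M borel)" for a :: real and S :: "(real \<times> real) set"
    using that by (rule sets_Pair1)
  have "measure (chanM \<kappa> \<mu>) S1 \<le> (K * sqrt (D / P) / l * ?G) * measure (exp_law \<kappa>) UNIV"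
    using assms pos slice[OF sets(1)]
    by (intro chanM_slices sets exp_law_interval[where v = 0]) (auto simp: S1_def dest: nn)
  also have "\<dots> \<le> (K * sqrt (D / P) / l * ?G) * 1"
    using assms by (intro mult_left_mono L.prob_le_1) auto
  also have "\<dots> = K / l * ?G * (1 / sqrt P) * sqrt D" by (simp add: real_sqrt_divide mult_ac)
  also have "\<dots> \<le> K / l * ?G * ?W * sqrt D"
    using assms W by (intro mult_right_mono mult_left_mono) auto
  finally have m1: "measure (chanM \<kappa> \<mu>) S1 \<le> K / l * ?G * ?W * sqrt D" .
  have "measure (exp_law \<kappa>) ({M..} \<union> {c / P..sqrt D}) \<le> measure (exp_law \<kappa>) {M..} + measure (exp_law \<kappa>) {c / P..sqrt D}"
    by (intro measure_Un_le) auto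
  also have "measure (exp_law \<kappa>) {M..} \<le> sqrt D"
    unfolding eM[symmetric] using assms(3) pos M0 by (intro exp_law_tail) auto
  also have "measure (exp_law \<kappa>) {c / P..sqrt D} \<le> sqrt D / l * exp (- 0 / L)"
    using assms pos by (intro exp_law_interval[where v = 0]) (auto dest: nn)
  finally have B2: "measure (exp_law \<kappa>) ({M..} \<union> {c / P..sqrt D}) \<le> (1 + 1 / l) * sqrt D"
    by (simp add: algebra_simps)
  have "measure (chanM \<kappa> \<mu>) S2 \<le> (K / P / l * ?G) * measure (exp_law \<kappa>) ({M..} \<union> {c / P..sqrt D})"
    using assms pos slice[OF sets(2)]
    by (intro chanM_slices sets exp_law_interval[where v = 0]) (auto simp: S2_def dest: nn)
  also have "\<dots> \<le> (K / P / l * ?G) * ((1 + 1 / l) * sqrt D)"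
    using assms B2 by (intro mult_left_mono) auto
  also have "\<dots> = K / l * (1 + 1 / l) * ?G * (1 / P) * sqrt D" by (simp add: mult_ac)
  also have "\<dots> \<le> K / l * (1 + 1 / l) * ?G * ?W * sqrt D"
    using assms W by (intro mult_right_mono mult_left_mono) auto
  finally have m2: "measure (chanM \<kappa> \<mu>) S2 \<le> K / l * (1 + 1 / l) * ?G * ?W * sqrt D" .
  have B3: "measure (exp_law \<kappa>) {c / P..K / P} \<le> K / P / l * exp (- 0 / L)"
    using assms pos by (intro exp_law_interval[where v = 0]) (auto dest: nn)
  \<comment> \<open>The window has width \<open>2 * D\<close>, and \<open>D \<le> sqrt D\<close>;
    the factor \<open>1 / P\<close> comes from the base.\<close>
  have sl: "measure (exp_law \<mu>) (Pair a -` S3) \<le> 2 * D / l * ?G" for a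
    using assms pos slice[OF sets(3)]
    by (intro exp_law_interval[where v = "a - D"]) (auto simp: S3_def)
  have "measure (chanM \<kappa> \<mu>) S3 \<le> (2 * D / l * ?G) * measure (exp_law \<kappa>) {c / P..K / P}"
    using assms pos by (intro chanM_slices sets sl) (auto simp: S3_def)
  also have "\<dots> \<le> (2 * sqrt D / l * ?G) * (K / P / l * exp (- 0 / L))"
    using assms sD B3 by (intro mult_mono divide_right_mono) auto
  also have "\<dots> = 2 * K / l\<^sup>2 * ?G * (1 / P) * sqrt D" by (simp add: power2_eq_square mult_ac)
  also have "\<dots> \<le> 2 * K / l\<^sup>2 * ?G * ?W * sqrt D"
    using assms W by (intro mult_right_mono mult_left_mono) auto
  finally have m3: "measure (chanM \<kappa> \<mu>) S3 \<le> 2 * K / l\<^sup>2 * ?G * ?W * sqrt D" .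
  \<comment> \<open>Only the length of the window matters, so its left end may be any real, even
    where the denominator vanishes or is negative.\<close>
  have sl: "measure (exp_law \<mu>) (Pair a -` S4) \<le> K' * sqrt D / P / l * ?G" for a
    using assms pos slice[OF sets(4)]
    by (intro exp_law_interval[where v = "c / (P - c * (1 + c) / a)"]) (auto simp: S4_def)
  have "measure (chanM \<kappa> \<mu>) S4 \<le> (K' * sqrt D / P / l * ?G) * measure (exp_law \<kappa>) UNIV"
    using assms pos by (intro chanM_slices sets sl) auto
  also have "\<dots> \<le> (K' * sqrt D / P / l * ?G) * 1"
    using assms by (intro mult_left_mono L.prob_le_1) auto
  also have "\<dots> = K' / l * ?G * (1 / P) * sqrt D" by (simp add: mult_ac)
  also have "\<dots> \<le> K' / l * ?G * ?W * sqrt D"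
    using assms W by (intro mult_right_mono mult_left_mono) auto
  finally have m4: "measure (chanM \<kappa> \<mu>) S4 \<le> K' / l * ?G * ?W * sqrt D" .
  have ev: "S1 \<in> events" "S2 \<in> events" "S3 \<in> events" "S4 \<in> events" using sets sets_chanM by auto
  have "prob (loss_cover c K K' P D M) \<le> prob (S1 \<union> S2 \<union> S3 \<union> S4)"
    using ev by (intro finite_measure_mono) (auto simp: loss_cover_def S1_def S2_def S3_def S4_def)
  also have "\<dots> \<le> prob S1 + prob S2 + prob S3 + prob S4"
    using ev measure_Un_le[of "S1 \<union> S2 \<union> S3" "chanM \<kappa> \<mu>" S4] measure_Un_le[of "S1 \<union> S2" "chanM \<kappa> \<mu>" S3]
      measure_Un_le[of "S1" "chanM \<kappa> \<mu>" S2] by auto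
  also have "\<dots> \<le> K / l * ?G * ?W * sqrt D + K / l * (1 + 1 / l) * ?G * ?W * sqrt D
      + 2 * K / l\<^sup>2 * ?G * ?W * sqrt D + K' / l * ?G * ?W * sqrt D"
    using m1 m2 m3 m4 by linarith
  also have "\<dots> = (K / l + K / l * (1 + 1 / l) + 2 * K / l\<^sup>2 + K' / l) * ?G * ?W * sqrt D"
    by (simp only: distrib_right)
  finally show ?thesis by simp
qed

text \<open>Each of the two tails is at most \<open>sqrt D\<close> and at most \<open>?G\<close>.
  For \<open>P \<le> 1\<close> one bound of each kind suffices, as \<open>?W\<close> is at least 1.
  For larger \<open>P\<close> the factor \<open>?G\<close> is bounded below, and
  \<open>D \<le> K / P\<close> turns one \<open>sqrt D\<close> into a multiple of
  \<open>1 / sqrt P\<close>.\<close>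

lemma measure_both_overload:
  assumes "0 < l" "l \<le> \<kappa>" "\<kappa> \<le> L" "l \<le> \<mu>" "\<mu> \<le> L" "P > 0" "0 < D" "D \<le> 1" "0 < c" "0 < K"
    and M: "M = L / 2 * ln (1 / D)" and "D \<le> K / P"
  shows "measure (chanM \<kappa> \<mu>) {h. M < fst h \<and> M < snd h \<and> c / P \<le> fst h \<and> c / P \<le> snd h}
    \<le> (1 + sqrt K * exp (c / L)) * exp (- c / P / L) * ((1 + sqrt P) / P) * sqrt D"
proof -
  interpret prob_space "chanM \<kappa> \<mu>" using assms by (intro prob_space_chanM) auto
  let ?G = "exp (- (c / P) / L)" and ?W = "(1 + sqrt P) / P"
  let ?S = "{h. M < fst h \<and> M < snd h \<and> c / P \<le> fst h \<and> c / P \<le> snd h}"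
  define m where "m = max M (c / P)"
  have pos: "c / P > 0" "\<kappa> > 0" "\<mu> > 0" "L > 0" using assms by auto
  have m0: "m \<ge> 0" "m \<ge> M" "m \<ge> c / P" using pos unfolding m_def by auto
  have eM: "exp (- M / L) = sqrt D" unfolding M using assms by (intro exp_threshold_eq_sqrt) auto
  have S: "{m..} \<times> {m..} \<in> sets (borel \<Otimes>\<^sub>M borel)" by (intro pair_measureI) auto
  have "measure (chanM \<kappa> \<mu>) ?S \<le> measure (chanM \<kappa> \<mu>) ({m..} \<times> {m..})"
    using S sets_chanM by (intro finite_measure_mono) (auto simp: m_def)
  also have "\<dots> \<le> exp (- m / L) * measure (exp_law \<kappa>) {m..}"
    using S pos m0 assms exp_law_tail[of \<mu> L m] by (intro chanM_slices) auto
  also have "\<dots> \<le> exp (- m / L) * exp (- m / L)"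
    using pos m0 assms by (intro mult_left_mono exp_law_tail) auto
  finally have b: "measure (chanM \<kappa> \<mu>) ?S \<le> exp (- m / L) * exp (- m / L)" .
  have eM': "exp (- m / L) \<le> sqrt D" unfolding eM[symmetric] using m0 pos by (auto intro!: divide_right_mono)
  have "c / P / L \<le> m / L" using m0 pos by (intro divide_right_mono) auto
  then have eG: "exp (- m / L) \<le> ?G" by simp
  show ?thesis
  proof (cases "P \<le> 1")
    case True
    have "1 \<le> ?W" using True assms by (simp add: pos_le_divide_eq add_increasing2)
    have "exp (- m / L) * exp (- m / L) \<le> ?G * sqrt D" using eM' eG by (intro mult_mono) auto
    also have "\<dots> \<le> (1 + sqrt K * exp (c / L)) * ?G * ?W * sqrt D"
    proof -
      have "1 * ?G * 1 * sqrt D \<le> (1 + sqrt K * exp (c / L)) * ?G * ?W * sqrt D"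
        using assms \<open>1 \<le> ?W\<close> by (intro mult_mono) auto
      then show ?thesis by simp
    qed
    finally show ?thesis using b by simp
  next
    case False
    have "c / P / L \<le> c / L" using False assms pos by (intro divide_right_mono) (auto simp: field_simps)
    then have G1: "1 \<le> exp (c / L) * ?G" by (simp add: exp_add[symmetric])
    have W: "1 / sqrt P \<le> ?W" using assms by (auto simp: field_simps)
    have "sqrt D \<le> sqrt (K / P)" using assms by simp
    then have D: "sqrt D \<le> sqrt K * (1 / sqrt P)" by (simp add: real_sqrt_divide)
    have "exp (- m / L) * exp (- m / L) \<le> sqrt D * sqrt D" using eM' \<open>0 < D\<close> by (intro mult_mono) auto
    also have "\<dots> \<le> (sqrt K * (1 / sqrt P)) * sqrt D" using D assms by (intro mult_right_mono) auto
    also have "\<dots> = sqrt K * 1 * (1 / sqrt P) * sqrt D" by simp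
    also have "\<dots> \<le> sqrt K * (exp (c / L) * ?G) * ?W * sqrt D"
      using W G1 assms by (intro mult_mono) auto
    also have "\<dots> = (sqrt K * exp (c / L)) * ?G * ?W * sqrt D" by simp
    also have "\<dots> \<le> (1 + sqrt K * exp (c / L)) * ?G * ?W * sqrt D"
      using assms by (intro mult_right_mono) auto
    finally show ?thesis using b by simp
  qed
qed

section \<open>The feedback rate\<close>

text \<open>Jensen's inequality through the tangent of the logarithm at \<open>z\<close>, the mean
  of \<open>x / D + 3\<close>; the linear correction then has mean zero. The 3 is the shift 2 of the
  codeword index plus 1 for rounding up.\<close>

lemma R_VLE_le:
  assumes "\<kappa> > 0" "D > 0" "T \<ge> 0"
  shows "R_VLE \<kappa> D T \<le> log 2 (\<kappa> / D + 3)"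
proof -
  interpret prob_space "exp_law \<kappa>" by (rule prob_space_exp_law) fact
  define z where "z = \<kappa> / D + 3"
  have z: "z \<ge> 3" unfolding z_def using assms by simp
  define f where "f x = log 2 z + (x / D + 3 - z) / (z * ln 2)" for x
  have tangent: "log 2 w \<le> log 2 z + (w - z) / (z * ln 2)" if "w > 0" for w
  proof -
    have "ln (w / z) \<le> w / z - 1" using that z by (intro ln_le_minus_one) auto
    then have "ln w - ln z \<le> (w - z) / z" using that z by (simp add: ln_div diff_divide_distrib)
    then have "(ln w - ln z) / ln 2 \<le> (w - z) / z / ln 2" by (intro divide_right_mono) auto
    then have "log 2 w - log 2 z \<le> (w - z) / (z * ln 2)" unfolding log_def diff_divide_distrib[symmetric] by simp
    then show ?thesis by linarith
  qed
  have dist: "distributed (exp_law \<kappa>) lborel (\<lambda>x. x) (exponential_density (1 / \<kappa>))"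
    by (rule exp_law_distributed) fact
  have int: "integrable (exp_law \<kappa>) (\<lambda>x. x)"
    using erlang_ith_moment_integrable[OF _ dist, of 1] assms by simp
  have ex: "expectation (\<lambda>x. x) = \<kappa>"
    using exponential_distributed_expectation[OF _ dist] assms by simp
  have intf: "integrable (exp_law \<kappa>) f" unfolding f_def using int by simp
  have "expectation f = log 2 z + (\<kappa> / D + 3 - z) / (z * ln 2)"
    unfolding f_def using int ex prob_space by simp
  also have "\<dots> = log 2 z" unfolding z_def by simp
  finally have Ef: "expectation f = log 2 z" .
  have AEpos: "AE x in exp_law \<kappa>. 0 \<le> x"
    by (subst AE_density) (auto simp: exponential_density_def)
  \<comment> \<open>The second conjunct is the nonnegativity that the comparison of integrals asks
    of the integrable majorant \<open>f\<close>.\<close>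
  have le: "real_of_int \<lfloor>log 2 (qidx D T x + 2)\<rfloor> \<le> f x \<and> 0 \<le> f x" if "0 \<le> x" for x
  proof -
    have "0 \<le> real_of_int \<lceil>x / D\<rceil>" using that assms by (smt (verit) divide_nonneg_pos le_of_int_ceiling)
    then have q: "0 \<le> qidx D T x" "qidx D T x \<le> x / D + 1"
      using assms of_int_ceiling_le_add_one[of "x / D"]
      unfolding qidx_def by (auto simp: pos_le_divide_eq)
    have "real_of_int \<lfloor>log 2 (qidx D T x + 2)\<rfloor> \<le> log 2 (qidx D T x + 2)" by simp
    also have "\<dots> \<le> log 2 (x / D + 3)" using q by (intro log_mono) auto
    also have "\<dots> \<le> f x" unfolding f_def using q by (intro tangent) linarith
    finally have 1: "real_of_int \<lfloor>log 2 (qidx D T x + 2)\<rfloor> \<le> f x" .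
    have "0 \<le> log 2 (x / D + 3)" using q by (subst zero_le_log_cancel_iff) linarith+
    also have "\<dots> \<le> f x" unfolding f_def using q by (intro tangent) linarith
    finally show ?thesis using 1 by simp
  qed
  have "R_VLE \<kappa> D T \<le> expectation f"
    unfolding R_VLE_def using intf AEpos le by (intro integral_mono_AE') auto
  then show ?thesis using Ef z_def by simp
qed

lemma sqrt_le_rate:
  assumes "\<kappa> > 0" "0 < D" "D \<le> 1" "T \<ge> 0" "R \<le> R_VLE \<kappa> D T"
  shows "sqrt D \<le> sqrt (\<kappa> + 3) * 2 powr (- R / 2)"
proof -
  have p: "\<kappa> / D + 3 > 0" using assms by (simp add: add_pos_pos)
  have "R \<le> log 2 (\<kappa> / D + 3)" using R_VLE_le[of \<kappa> D T] assms by linarith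
  \<comment> \<open>Here \<open>D \<le> 1\<close> gives \<open>3 \<le> 3 / D\<close>.\<close>
  also have "\<dots> \<le> log 2 ((\<kappa> + 3) / D)" using assms p by (intro log_mono) (auto simp: field_simps)
  finally have "2 powr (- log 2 ((\<kappa> + 3) / D) / 2) \<le> 2 powr (- R / 2)" by simp
  moreover have "2 powr (- log 2 ((\<kappa> + 3) / D) / 2) = (2 powr log 2 ((\<kappa> + 3) / D)) powr (- 1 / 2)"
    by (simp add: powr_powr)
  moreover have "\<dots> = ((\<kappa> + 3) / D) powr (- 1 / 2)" using assms by simp
  moreover have "\<dots> = 1 / sqrt ((\<kappa> + 3) / D)"
    using assms by (simp add: powr_minus_divide powr_half_sqrt flip: minus_divide_left)
  moreover have "\<dots> = sqrt D / sqrt (\<kappa> + 3)" by (simp add: real_sqrt_divide)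
  ultimately have "sqrt D / sqrt (\<kappa> + 3) \<le> 2 powr (- R / 2)" by metis
  then show ?thesis using assms by (simp add: pos_divide_le_eq mult.commute)
qed

section \<open>Assembling the bound\<close>

text \<open>A union bound: quantized outage lies in full-CSI outage, two null sets, the cover in
  both orientations and the double overload. Subtracting the full-CSI outage leaves the
  rest.\<close>

lemma out_loss_le:
  assumes "0 < lam2" "lam2 \<le> lam1" "rth > 0" "P > 0" "0 < D" "D \<le> 1"
    and T: "T = lam1 / (2 * D) * ln (1 / D)"
  defines "c \<equiv> 2 powr rth - 1"
  defines "K \<equiv> 1 + 18 * c\<^sup>2 + 4 * c"
  defines "K' \<equiv> (1 + c) * K + (1 + c) * K\<^sup>2 / c"
  shows "out_loss lam1 lam2 P rth D T
    \<le> (2 * (K / lam2 + K / lam2 * (1 + 1 / lam2) + 2 * K / lam2\<^sup>2 + K' / lam2) + (1 + sqrt K * exp (c / lam1)))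
      * exp (- c / P / lam1) * ((1 + sqrt P) / P) * sqrt D"
proof -
  let ?M = "chanM lam1 lam2"
  let ?E = "exp (- c / P / lam1) * ((1 + sqrt P) / P) * sqrt D"
  let ?A = "K / lam2 + K / lam2 * (1 + 1 / lam2) + 2 * K / lam2\<^sup>2 + K' / lam2"
  interpret prob_space ?M using assms by (intro prob_space_chanM) auto
  have lam: "lam1 > 0" using assms by simp
  have c: "c > 0" unfolding c_def using assms powr_less_mono[of 0 rth 2] by simp
  then have K: "K > 0" unfolding K_def by (intro add_pos_pos) auto
  then have K': "K' > 0" unfolding K'_def using c by (intro add_pos_pos mult_pos_pos divide_pos_pos) auto
  have TD: "T * D = lam1 / 2 * ln (1 / D)" using T assms by simp
  have T0: "T \<ge> 0" using T assms by simp
  define C1 where "C1 = loss_cover c K K' P D (T * D)"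
  define C2 where "C2 = {h. (snd h, fst h) \<in> C1}"
  \<comment> \<open>The condition on \<open>D\<close> does not involve the gains, so it decides
    whether the whole event counts; \<open>measure_both_overload\<close> relies on it.\<close>
  define C3 where "C3 = (if D \<le> K / P then {h. T * D < fst h \<and> T * D < snd h \<and> c / P \<le> fst h \<and> c / P \<le> snd h} else {})"
  \<comment> \<open>Nonpositive gains have probability zero but are points of the space, and
    \<open>loss_event_covered\<close> speaks only of positive gains.\<close>
  define N1 N2 where "N1 = {..0 :: real} \<times> (UNIV :: real set)" and "N2 = (UNIV :: real set) \<times> {..0 :: real}"
  define R Q where "R = {h. rmax P (fst h) (snd h) < rth}" and "Q = {h. rq P D T (fst h) (snd h) < rth}"
  have coll: "{h. X h} \<in> sets (borel \<Otimes>\<^sub>M borel)" if "{h \<in> space (borel \<Otimes>\<^sub>M borel). X h} \<in> sets (borel \<Otimes>\<^sub>M borel)"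
    for X :: "real \<times> real \<Rightarrow> bool" using that by (simp add: space_pair_measure)
  have sC1: "C1 \<in> sets (borel \<Otimes>\<^sub>M borel)" unfolding C1_def by (rule sets_loss_cover)
  have "(\<lambda>h. (snd h, fst h)) -` C1 \<inter> space (borel \<Otimes>\<^sub>M borel) \<in> sets (borel \<Otimes>\<^sub>M borel)"
    by (rule measurable_sets[OF _ sC1]) measurable
  then have sC2: "C2 \<in> sets (borel \<Otimes>\<^sub>M borel)" unfolding C2_def by (simp add: space_pair_measure vimage_def)
  have sC3: "C3 \<in> sets (borel \<Otimes>\<^sub>M borel)" 
  proof -
    have "{h :: real \<times> real. T * D < fst h \<and> T * D < snd h \<and> c / P \<le> fst h \<and> c / P \<le> snd h} \<in> sets (borel \<Otimes>\<^sub>M borel)"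
      by (rule coll) measurable
    then show ?thesis unfolding C3_def by simp
  qed
  have sR: "R \<in> sets (borel \<Otimes>\<^sub>M borel)" unfolding R_def rmax_def Acoef_def by (rule coll) measurable
  have sN: "N1 \<in> sets (borel \<Otimes>\<^sub>M borel)" "N2 \<in> sets (borel \<Otimes>\<^sub>M borel)" unfolding N1_def N2_def
    by (intro pair_measureI; simp)+
  have "prob N1 \<le> 1 * measure (exp_law lam1) {..0}"
    using assms lam sN prob_space.prob_le_1[OF prob_space_exp_law[of lam2]]
    by (intro chanM_slices) (auto simp: N1_def)
  then have N1: "prob N1 \<le> 0" using exp_law_nonpos[OF lam] by simp
  have "prob N2 \<le> 0 * measure (exp_law lam1) UNIV"
    using assms lam sN exp_law_nonpos[of lam2]
    by (intro chanM_slices) (auto simp: N2_def vimage_def atMost_def)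
  then have N2: "prob N2 \<le> 0" by simp
  have p1: "prob C1 \<le> ?A * exp (- c / P / lam1) * ((1 + sqrt P) / P) * sqrt D"
    unfolding C1_def using assms c K K' TD by (intro measure_loss_cover) auto
  have "prob C2 = measure (chanM lam2 lam1) C1"
    unfolding C2_def using assms lam sC1 by (intro chanM_swap) auto
  also have "\<dots> \<le> ?A * exp (- c / P / lam1) * ((1 + sqrt P) / P) * sqrt D"
    unfolding C1_def using assms c K K' TD by (intro measure_loss_cover) auto
  finally have p2: "prob C2 \<le> ?A * exp (- c / P / lam1) * ((1 + sqrt P) / P) * sqrt D" .
  have p3: "prob C3 \<le> (1 + sqrt K * exp (c / lam1)) * exp (- c / P / lam1) * ((1 + sqrt P) / P) * sqrt D"
  proof (cases "D \<le> K / P")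
    case True
    have "measure ?M {h. T * D < fst h \<and> T * D < snd h \<and> c / P \<le> fst h \<and> c / P \<le> snd h}
       \<le> (1 + sqrt K * exp (c / lam1)) * exp (- c / P / lam1) * ((1 + sqrt P) / P) * sqrt D"
      using assms(1-6) c K True TD by (intro measure_both_overload[where l = lam2]) auto
    then show ?thesis using True unfolding C3_def by simp
  next
    case False
    then show ?thesis unfolding C3_def using assms K by simp
  qed
  have sub: "Q \<subseteq> R \<union> N1 \<union> N2 \<union> C1 \<union> C2 \<union> C3"
  proof
    fix h assume h: "h \<in> Q"
    obtain h1 h2 where hh: "h = (h1, h2)" by fastforce
    show "h \<in> R \<union> N1 \<union> N2 \<union> C1 \<union> C2 \<union> C3"
    proof (cases "h1 \<le> 0 \<or> h2 \<le> 0 \<or> rmax P h1 h2 < rth")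
      case True
      then show ?thesis unfolding N1_def N2_def R_def hh by auto
    next
      case False
      have "(h1, h2) \<in> loss_cover c K K' P D (T * D) \<or> (h2, h1) \<in> loss_cover c K K' P D (T * D) \<or>
        (T * D < h1 \<and> T * D < h2 \<and> c / P \<le> h1 \<and> c / P \<le> h2 \<and> D \<le> K / P)"
        unfolding c_def K_def K'_def
        by (rule loss_event_covered) (use assms(1-6) T0 h False in \<open>auto simp: Q_def hh\<close>)
      then show ?thesis unfolding hh C1_def C2_def C3_def by auto
    qed
  qed
  have ev: "R \<in> events" "N1 \<in> events" "N2 \<in> events" "C1 \<in> events" "C2 \<in> events" "C3 \<in> events"
    using sR sN sC1 sC2 sC3 sets_chanM by auto
  have "prob Q \<le> prob (R \<union> N1 \<union> N2 \<union> C1 \<union> C2 \<union> C3)"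
    using sub ev by (intro finite_measure_mono) auto
  also have "\<dots> \<le> prob R + prob N1 + prob N2 + prob C1 + prob C2 + prob C3"
    using ev measure_Un_le[of "R \<union> N1 \<union> N2 \<union> C1 \<union> C2" ?M C3] measure_Un_le[of "R \<union> N1 \<union> N2 \<union> C1" ?M C2]
      measure_Un_le[of "R \<union> N1 \<union> N2" ?M C1] measure_Un_le[of "R \<union> N1" ?M N2] measure_Un_le[of R ?M N1] by auto
  finally have "prob Q - prob R \<le> 2 * (?A * ?E) + (1 + sqrt K * exp (c / lam1)) * ?E"
    using N1 N2 p1 p2 p3 by (simp add: mult.assoc)
  also have "\<dots> = (2 * ?A + (1 + sqrt K * exp (c / lam1))) * ?E" by (simp only: distrib_right mult.assoc)
  finally show ?thesis unfolding out_loss_def out_q_def out_min_def R_def Q_def by (simp add: mult.assoc)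
qed

theorem theorem3:
  fixes lam1 lam2 rth :: real
  assumes "lam1 \<ge> lam2" and "lam2 > 0" and "rth > 0"
  shows "\<exists>C6 C8 :: real. C6 > 0 \<and> C8 > 0 \<and>
    (\<forall>Delta P T. 0 < Delta \<longrightarrow> Delta \<le> 1 \<longrightarrow> T = lam1 / (2 * Delta) * ln (1 / Delta) \<longrightarrow> P > 0 \<longrightarrow>
       out_loss lam1 lam2 P rth Delta T
         \<le> C8 * exp (- C6 / P) * (1 + sqrt P) / P
             * 2 powr (- min (R_VLE lam1 Delta T) (R_VLE lam2 Delta T) / 2))"
proof -
  define c where "c = 2 powr rth - 1"
  define K where "K = 1 + 18 * c\<^sup>2 + 4 * c"
  define K' where "K' = (1 + c) * K + (1 + c) * K\<^sup>2 / c"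
  define B where "B = 2 * (K / lam2 + K / lam2 * (1 + 1 / lam2) + 2 * K / lam2\<^sup>2 + K' / lam2) + (1 + sqrt K * exp (c / lam1))"
  have c: "c > 0" unfolding c_def using assms powr_less_mono[of 0 rth 2] by simp
  then have K: "K > 0" unfolding K_def by (intro add_pos_pos) auto
  then have K': "K' > 0" unfolding K'_def using c by (intro add_pos_pos mult_pos_pos divide_pos_pos) auto
  have B: "B > 0" unfolding B_def using assms K K' by (intro add_pos_pos mult_pos_pos divide_pos_pos) auto
  have bound: "out_loss lam1 lam2 P rth D T \<le> (B * sqrt (lam2 + 3)) * exp (- (c / lam1) / P) * (1 + sqrt P) / P
      * 2 powr (- min (R_VLE lam1 D T) (R_VLE lam2 D T) / 2)"
    if "0 < D" "D \<le> 1" "T = lam1 / (2 * D) * ln (1 / D)" "P > 0" for D P T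
  proof -
    have T0: "T \<ge> 0" using that assms by simp
    have "out_loss lam1 lam2 P rth D T \<le> B * exp (- c / P / lam1) * ((1 + sqrt P) / P) * sqrt D"
      unfolding B_def K'_def K_def c_def using assms that by (intro out_loss_le) auto
    \<comment> \<open>The minimum of the rates is at most the rate of Receiver 2, so the mean
      \<open>lam2\<close> enters the constant. The exponent \<open>c / lam1\<close> comes from the
      larger mean, whose tail decays more slowly.\<close>
    also have "\<dots> \<le> B * exp (- c / P / lam1) * ((1 + sqrt P) / P) *
        (sqrt (lam2 + 3) * 2 powr (- min (R_VLE lam1 D T) (R_VLE lam2 D T) / 2))"
      using assms(2) that(1,2,4) B T0 by (intro mult_left_mono sqrt_le_rate[where T = T]) auto
    finally show ?thesis by (simp add: mult_ac)
  qed
  show ?thesis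
    using bound c B assms by (intro exI[of _ "c / lam1"] exI[of _ "B * sqrt (lam2 + 3)"]) auto
qed

end
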